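(* For every integer $k\ge 1$, let $U_{3^k}$ be the multiplicative group of units of the ring $G(\mathbb{Z}_{3^k})$ of polyfunctions over $\mathbb{Z}_{3^k}$. Then $$|U_{3^k}|=\Big(\frac23\Big)^3\,\Psi(3^k)=\Big(\frac23\Big)^3\,3^{\sum_{i=1}^k s(3^i)}.$$ In other words, the fraction of units among all polyfunctions in $G(\mathbb{Z}_{3^k})$ is $\frac{8}{27}$, independently of $k$.
   Context: $\mathbb{Z}_n=\mathbb{Z}/n\mathbb{Z}$. $G(\mathbb{Z}_n)$ is the ring of functions $f:\mathbb{Z}_n\to\mathbb{Z}_n$ for which there is a polynomial $p\in\mathbb{Z}_n[x]$ with $f(x)=p(x)$ for all $x\in\mathbb{Z}_n$, with pointwise addition and multiplication, and $\Psi(n):=|G(\mathbb{Z}_n)|$. The Smarandache function is $s(n):=\min\{j\in\mathbb{N}: n\mid j!\}$. *)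

theory Defs
  imports "HOL-Algebra.UnivPoly" "HOL-Number_Theory.Residues"
begin

text \<open>
  Functions on \<open>carrier R\<close> are taken extensional, so that equality of elements of the ring
  of polyfunctions (and hence its cardinality) is equality on \<open>carrier R\<close>.
\<close>

definition polyfun_ring :: "('a, 'b) ring_scheme \<Rightarrow> ('a \<Rightarrow> 'a) ring" where
  "polyfun_ring R =
     \<lparr> carrier = {f \<in> carrier R \<rightarrow>\<^sub>E carrier R.
                   \<exists>p \<in> carrier (UP R). \<forall>x \<in> carrier R. f x = UnivPoly.eval R R id x p},
       monoid.mult = (\<lambda>f g. \<lambda>x\<in>carrier R. f x \<otimes>\<^bsub>R\<^esub> g x),
       one = (\<lambda>x\<in>carrier R. \<one>\<^bsub>R\<^esub>),
       ring.zero = (\<lambda>x\<in>carrier R. \<zero>\<^bsub>R\<^esub>),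
       ring.add = (\<lambda>f g. \<lambda>x\<in>carrier R. f x \<oplus>\<^bsub>R\<^esub> g x) \<rparr>"

text \<open>
  \<open>residue_ring n\<close> is a ring only for \<open>n \<ge> 2\<close>; \<open>G\<close> and \<open>Psi\<close> below are meant for
  such \<open>n\<close>.
\<close>

definition G :: "nat \<Rightarrow> (int \<Rightarrow> int) ring" where
  "G n = polyfun_ring (residue_ring (int n))"

definition Psi :: "nat \<Rightarrow> nat" where
  "Psi n = card (carrier (G n))"

definition smarandache :: "nat \<Rightarrow> nat" where
  "smarandache n = (LEAST j. n dvd fact j)"

end

theory Submission
  imports "HOL-Computational_Algebra.Polynomial" Defs
begin

text \<open>
  Two independent counts give the result, both for an arbitrary prime \<open>p\<close> in place of 3.

  \<^item> \<open>\<Psi>(n)\<close>. On the arguments \<open>0, \<dots>, n - 1\<close> every integer polynomial agrees with a Newton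
  expansion \<open>\<Sum>j<n. a\<^sub>j \<cdot> j! \<cdot> (x choose j)\<close>. Evaluating at \<open>x = 0, 1, 2, \<dots>\<close> in turn shows
  that the expansion vanishes modulo \<open>n\<close> exactly if \<open>n\<close> divides each \<open>a\<^sub>j \<cdot> j!\<close>, that is, if
  \<open>n / gcd(n, j!)\<close> divides \<open>a\<^sub>j\<close>. Hence \<open>\<Psi>(n) = (\<Prod>j<n. n / gcd(n, j!))\<close>
  (\<open>Psi_eq_prod\<close>). For \<open>n = p\<^sup>k\<close> the exponent of \<open>p\<close> in the \<open>j\<close>-th factor is the number of
  \<open>i\<close> in \<open>{1..k}\<close> for which \<open>p\<^sup>i\<close> does not divide \<open>j!\<close>; exchanging the two counts, each \<open>i\<close>
  is met by exactly the \<open>j < s(p\<^sup>i)\<close> (\<open>Psi_primepow\<close>).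

  \<^item> Units. A polyfunction \<open>f\<close> modulo \<open>p\<^sup>k\<close> is a unit exactly if no value of it is divisible by
  \<open>p\<close>: the inverse is then a power of \<open>f\<close>, by Euler's theorem, so it is again a polyfunction.
  This condition only concerns the reduction of \<open>f\<close> modulo \<open>p\<close>, which can be any of the
  \<open>p\<^sup>p\<close> functions on \<open>\<int>\<^sub>p\<close>, and all fibres of the reduction have the same size because
  they are translates of each other. So the proportion of units is the proportion
  \<open>((p - 1) / p)\<^sup>p\<close> of nowhere vanishing functions on \<open>\<int>\<^sub>p\<close>
  (\<open>card_Units_primepow\<close>), which is \<open>(2/3)\<^sup>3\<close> for \<open>p = 3\<close>.
\<close>

section \<open>Polyfunctions as reductions of integer polynomials\<close>

definition poly_map :: "nat \<Rightarrow> int poly \<Rightarrow> int \<Rightarrow> int" where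
  "poly_map n q = (\<lambda>x\<in>{0..<int n}. poly q x mod int n)"

lemma poly_map_eq_iff:
  "poly_map n q = poly_map n q' \<longleftrightarrow> (\<forall>x\<in>{0..<int n}. poly q x mod int n = poly q' x mod int n)"
  by (auto simp: poly_map_def fun_eq_iff restrict_def)

lemma poly_mod_arg: "poly q (x mod m) mod m = poly q x mod (m :: int)"
proof (induction q)
  case (pCons c q)
  have "poly (pCons c q) (x mod m) mod m = (c + (x mod m) * (poly q (x mod m) mod m)) mod m"
    by (metis mod_add_right_eq mod_mult_right_eq poly_pCons)
  also have "\<dots> = poly (pCons c q) x mod m"
    unfolding pCons.IH by (metis mod_add_right_eq mod_mult_eq poly_pCons)
  finally show ?case .
qed simp

text \<open>
  Only the residues of the coefficients of \<open>q\<close> are prescribed, so \<open>q\<close> may have a larger degree than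
  \<open>p\<close>; its coefficients beyond \<open>deg R p\<close> are multiples of \<open>n\<close> and do not affect the value.
\<close>
lemma eval_residue_ring:
  fixes n :: nat
  defines "R \<equiv> residue_ring (int n)"
  assumes n: "n > 1" and p: "p \<in> carrier (UP R)" and x: "x \<in> carrier R"
    and q: "\<And>i. Polynomial.coeff q i mod int n = p i"
  shows "UnivPoly.eval R R id x p = poly q x mod int n"
proof -
  interpret residues "int n" R
    using n unfolding R_def by unfold_locales simp_all
  interpret UP_ring R "UP R" by unfold_locales simp_all
  define D where "D = deg R p"
  define M where "M = max D (Polynomial.degree q)"
  have coeff_p: "UnivPoly.coeff (UP R) p i = p i" for i
    using p by (simp add: UP_def)
  have x_mod: "x = x mod int n"
    using x by (simp add: res_carrier_eq)
  have "UnivPoly.eval R R id x p = (\<Oplus>\<^bsub>R\<^esub>i\<in>{..D}. (Polynomial.coeff q i mod int n) \<otimes>\<^bsub>R\<^esub> (x [^]\<^bsub>R\<^esub> i))"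
    using p by (simp add: UnivPoly.eval_def coeff_p q D_def)
  also have "\<dots> = (\<Oplus>\<^bsub>R\<^esub>i\<in>{..D}. (Polynomial.coeff q i * x ^ i) mod int n)"
    by (subst x_mod) (simp only: pow_cong mult_cong)
  also have "\<dots> = (\<Sum>i\<le>D. Polynomial.coeff q i * x ^ i) mod int n"
    by (rule sum_cong) simp
  also have "\<dots> = (\<Sum>i\<le>D. Polynomial.coeff q i * x ^ i mod int n) mod int n"
    by (simp add: mod_sum_eq)
  also have "(\<Sum>i\<le>D. Polynomial.coeff q i * x ^ i mod int n) = (\<Sum>i\<le>M. Polynomial.coeff q i * x ^ i mod int n)"
  proof (rule sum.mono_neutral_left)
    have "Polynomial.coeff q i mod int n = 0" if "i > D" for i
      using deg_aboveD[OF _ p, of i] that p by (simp add: q D_def coeff_p zero_cong)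
    then show "\<forall>i\<in>{..M} - {..D}. Polynomial.coeff q i * x ^ i mod int n = 0"
      by (auto simp: mod_eq_0_iff_dvd)
  qed (auto simp: M_def)
  also have "\<dots> mod int n = (\<Sum>i\<le>M. Polynomial.coeff q i * x ^ i) mod int n"
    by (simp add: mod_sum_eq)
  also have "(\<Sum>i\<le>M. Polynomial.coeff q i * x ^ i) = poly q x"
    unfolding poly_altdef
    by (rule sum.mono_neutral_right) (auto simp: M_def Polynomial.coeff_eq_0)
  finally show ?thesis .
qed

text \<open>
  Lifting coefficients from \<open>\<int>\<^sub>n\<close> to \<open>\<int>\<close> replaces polynomials over the residue ring, with their
  carrier conditions, by the type \<open>int poly\<close>. It also lets polyfunctions for different
  moduli be represented by the same polynomial.
\<close>
lemma carrier_G: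
  assumes n: "n > 1"
  shows "carrier (G n) = range (poly_map n)"
proof -
  define R where "R = residue_ring (int n)"
  interpret residues "int n" R
    using n unfolding R_def by unfold_locales simp_all
  have carrier_R: "carrier R = {0..<int n}"
    by (auto simp: res_carrier_eq)
  have G: "carrier (G n) = {f \<in> carrier R \<rightarrow>\<^sub>E carrier R.
                   \<exists>p \<in> carrier (UP R). \<forall>x \<in> carrier R. f x = UnivPoly.eval R R id x p}"
    by (simp add: G_def polyfun_ring_def R_def)
  show ?thesis
  proof (intro equalityI subsetI)
    fix f assume "f \<in> carrier (G n)"
    then obtain p where f: "f \<in> carrier R \<rightarrow>\<^sub>E carrier R" and p: "p \<in> carrier (UP R)"
      and eval: "\<And>x. x \<in> carrier R \<Longrightarrow> f x = UnivPoly.eval R R id x p"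
      unfolding G by blast
    have p_mod: "p i mod int n = p i" for i
      using p by (auto simp: UP_def up_def carrier_R Pi_iff)
    obtain N where N: "bound \<zero>\<^bsub>R\<^esub> N p"
      using p by (auto simp: UP_def up_def)
    define q where "q = Abs_poly p"
    have "\<forall>\<^sub>\<infinity>i. p i = 0"
      unfolding MOST_nat using N by (auto simp: bound_def zero_cong)
    then have q: "Polynomial.coeff q i = p i" for i
      by (simp add: q_def Abs_poly_inverse)
    have "f x = poly_map n q x" for x
    proof (cases "x \<in> carrier R")
      case True
      then show ?thesis
        using eval[OF True] eval_residue_ring[OF n p[unfolded R_def] True[unfolded R_def], of q]
          True by (simp add: q p_mod poly_map_def carrier_R flip: R_def)
    next
      case False
      then show ?thesis
        using f by (auto simp: poly_map_def carrier_R PiE_def extensional_def)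
    qed
    then show "f \<in> range (poly_map n)" by blast
  next
    fix f assume "f \<in> range (poly_map n)"
    then obtain q where f: "f = poly_map n q" by blast
    define p where "p = (\<lambda>i. Polynomial.coeff q i mod int n)"
    have "bound \<zero>\<^bsub>R\<^esub> (Polynomial.degree q) p"
      by (auto simp: p_def zero_cong Polynomial.coeff_eq_0)
    then have p: "p \<in> carrier (UP R)"
      by (auto simp: UP_def up_def p_def)
    have "f x = UnivPoly.eval R R id x p" if "x \<in> carrier R" for x
      using eval_residue_ring[OF n p[unfolded R_def] that[unfolded R_def], of q] that
      by (simp add: f p_def poly_map_def carrier_R flip: R_def)
    moreover have "f \<in> carrier R \<rightarrow>\<^sub>E carrier R"
      using n by (auto simp: f poly_map_def carrier_R)
    ultimately show "f \<in> carrier (G n)"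
      unfolding G using p by blast
  qed
qed

section \<open>Counting polyfunctions by Newton expansions\<close>

text \<open>
  The basis polynomial \<open>j! \<cdot> (x choose j)\<close> is the falling factorial \<open>x (x - 1) \<cdots> (x - j + 1)\<close>. Written
  with the binomial coefficient, it is visibly divisible by \<open>j!\<close>, zero for \<open>x < j\<close>, and equal
  to \<open>j!\<close> for \<open>x = j\<close>.
\<close>
definition newton :: "nat \<Rightarrow> (nat \<Rightarrow> int) \<Rightarrow> nat \<Rightarrow> int" where
  "newton n a x = (\<Sum>j<n. a j * (fact j * int (x choose j)))"

text \<open>
  Multiplication by \<open>x\<close> in the falling factorial basis: write \<open>x = (x - j) + j\<close>.
\<close>
lemma falling_step:
  "int x * (fact j * int (x choose j))
     = fact (Suc j) * int (x choose Suc j) + int j * (fact j * int (x choose j))"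
proof (cases "j \<le> x")
  case True
  have "Suc j * (x choose Suc j) = (x - j) * (x choose j)"
    by (simp only: binomial_absorption binomial_absorb_comp)
  then have "int (Suc j * (x choose Suc j)) = (int x - int j) * int (x choose j)"
    using True by (simp only: of_nat_mult of_nat_diff)
  then have "fact j * int (Suc j * (x choose Suc j)) = fact j * ((int x - int j) * int (x choose j))"
    by simp
  then show ?thesis
    by (simp add: algebra_simps)
qed (simp add: binomial_eq_0)

text \<open>
  Falling factorials of order at least \<open>n\<close> vanish at all arguments below \<open>n\<close>. This is why \<open>n\<close>
  coefficients suffice on these arguments, whatever the degree of the polynomial.
\<close>
lemma newton_expansion:
  "\<exists>a. \<forall>x<n. poly q (int x) = newton n a x"
proof (cases n)
  case (Suc m)
  show ?thesis unfolding Suc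
  proof (induction q)
    case 0
    have "\<forall>x<Suc m. poly 0 (int x) = newton (Suc m) (\<lambda>_. 0) x"
      by (simp add: newton_def)
    then show ?case by blast
  next
    case (pCons c q)
    then obtain a where a: "\<And>x. x < Suc m \<Longrightarrow> poly q (int x) = newton (Suc m) a x"
      by blast
    \<comment> \<open>By \<open>falling_step\<close>, multiplication by \<open>x\<close> sends the \<open>j\<close>-th basis element to the next
      one plus \<open>j\<close> times itself; the constant \<open>c\<close> takes the place left free at index 0.\<close>
    define b where "b j = (if j = 0 then c else a (j - 1)) + a j * int j" for j
    have "poly (pCons c q) (int x) = newton (Suc m) b x" if x: "x < Suc m" for x
    proof -
      define t where "t j = (fact j * int (x choose j) :: int)" for j
      have t_last: "t (Suc m) = 0" and t0: "t 0 = 1"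
        using x by (simp_all add: t_def binomial_eq_0)
      have "poly (pCons c q) (int x) = c + (\<Sum>j<Suc m. a j * (int x * t j))"
        by (simp only: poly_pCons a[OF x] newton_def sum_distrib_left t_def) (simp only: ac_simps)
      also have "\<dots> = c + (\<Sum>j<Suc m. a j * t (Suc j)) + (\<Sum>j<Suc m. a j * int j * t j)"
        by (simp only: t_def falling_step distrib_left sum.distrib) (simp only: ac_simps)
      also have "c + (\<Sum>j<Suc m. a j * t (Suc j)) = (\<Sum>j<Suc m. (if j = 0 then c else a (j - 1)) * t j)"
        by (subst (2) sum.lessThan_Suc_shift) (simp add: t_last t0)
      finally show ?thesis
        by (simp add: newton_def b_def t_def distrib_right sum.distrib)
    qed
    then show ?case by blast
  qed
qed simp

lemma falling_poly: "\<exists>q. \<forall>x. poly q (int x) = fact j * int (x choose j)"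
proof (induction j)
  case 0
  show ?case by (rule exI[of _ 1]) simp
next
  case (Suc j)
  then obtain q where "\<And>x. poly q (int x) = fact j * int (x choose j)" by blast
  then have "poly ([:- int j, 1:] * q) (int x) = fact (Suc j) * int (x choose Suc j)" for x
    using falling_step[of x j] by (simp add: algebra_simps)
  then show ?case by blast
qed

lemma newton_poly: "\<exists>q. \<forall>x. poly q (int x) = newton n a x"
proof -
  obtain c where c: "\<And>j x. poly (c j) (int x) = fact j * int (x choose j)"
    using falling_poly by metis
  have "poly (\<Sum>j<n. Polynomial.smult (a j) (c j)) (int x) = newton n a x" for x
    by (simp add: poly_sum newton_def c)
  then show ?thesis by blast
qed

text \<open>
  The system of congruences is triangular: at \<open>x = j\<close> all terms beyond the \<open>j\<close>-th vanish, and the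
  \<open>j\<close>-th difference is multiplied by \<open>j!\<close>. Induction on \<open>j\<close> removes the earlier terms. The
  converse holds because binomial coefficients are integers.
\<close>
lemma newton_cong_iff:
  "(\<forall>x<n. newton n a x mod m = newton n b x mod m)
     \<longleftrightarrow> (\<forall>j<n. m dvd (a j - b j) * fact j)"
proof
  assume eq: "\<forall>x<n. newton n a x mod m = newton n b x mod m"
  have "m dvd (a j - b j) * fact j" if "j < n" for j
    using that
  proof (induction j rule: less_induct)
    case (less j)
    have split: "{..<n} = {..<j} \<union> insert j {j<..<n}"
      using less.prems by auto
    have "newton n a j - newton n b j = (\<Sum>i<n. (a i - b i) * (fact i * int (j choose i)))"
      by (simp add: newton_def sum_subtractf left_diff_distrib)
    also have "\<dots> = (\<Sum>i<j. (a i - b i) * (fact i * int (j choose i))) + (a j - b j) * fact j"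
      unfolding split by (subst sum.union_disjoint) (auto simp: binomial_eq_0)
    finally have "(a j - b j) * fact j = (newton n a j - newton n b j)
        - (\<Sum>i<j. (a i - b i) * (fact i * int (j choose i)))"
      by simp
    moreover have "m dvd newton n a j - newton n b j"
      using eq less.prems by (simp add: mod_eq_dvd_iff)
    moreover have "m dvd (\<Sum>i<j. (a i - b i) * (fact i * int (j choose i)))"
      using less.IH less.prems by (intro dvd_sum) (simp flip: mult.assoc)
    ultimately show ?case
      by (simp only: dvd_diff)
  qed
  then show "\<forall>j<n. m dvd (a j - b j) * fact j" by blast
next
  assume dvd: "\<forall>j<n. m dvd (a j - b j) * fact j"
  have "m dvd newton n a x - newton n b x" for x
  proof -
    have "newton n a x - newton n b x = (\<Sum>j<n. (a j - b j) * fact j * int (x choose j))"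
      by (simp add: newton_def sum_subtractf left_diff_distrib mult.assoc)
    then show ?thesis
      using dvd by (auto intro!: dvd_sum)
  qed
  then show "\<forall>x<n. newton n a x mod m = newton n b x mod m"
    by (simp add: mod_eq_dvd_iff)
qed

lemma dvd_mult_iff_div_gcd_dvd:
  fixes n m :: nat and c :: int
  assumes "n > 0"
  shows "int n dvd c * int m \<longleftrightarrow> int (n div gcd n m) dvd c"
proof -
  define g where "g = gcd n m"
  have g: "g > 0" using assms by (simp add: g_def)
  obtain n' where n': "n = g * n'" using g_def by (metis gcd_dvd1 dvdE)
  obtain m' where m': "m = g * m'" using g_def by (metis gcd_dvd2 dvdE)
  have "coprime n' m'"
    using g g_def n' m' by (metis gcd_coprime mult.commute neq0_conv)
  then have cop: "coprime (int n') (int m')" by simp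
  have "int n dvd c * int m \<longleftrightarrow> int n' dvd c * int m'"
    using g by (simp add: n' m' mult.left_commute[of c])
  also have "\<dots> \<longleftrightarrow> int n' dvd c"
    by (rule coprime_dvd_mult_left_iff[OF cop])
  also have "n' = n div gcd n m"
    using g n' g_def by (metis nonzero_mult_div_cancel_left neq0_conv)
  finally show ?thesis .
qed

text \<open>
  By \<open>newton_cong_iff\<close>, the coefficient \<open>a\<^sub>j\<close> matters exactly modulo \<open>n / gcd(n, j!)\<close>, so restricting
  each \<open>a\<^sub>j\<close> to the least residues gives a normal form for polyfunctions.
\<close>
theorem Psi_eq_prod:
  assumes n: "n > 1"
  shows "Psi n = (\<Prod>j<n. n div gcd n (fact j))"
proof -
  define e where "e j = n div gcd n (fact j)" for j
  have e_pos: "e j > 0" for j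
    using n by (simp add: e_def div_greater_zero_iff dvd_imp_le)
  have dvd_iff: "int n dvd c * fact j \<longleftrightarrow> int (e j) dvd c" for c j
    using dvd_mult_iff_div_gcd_dvd[of n c "fact j"] n by (simp add: e_def)
  define A where "A = (\<Pi>\<^sub>E j\<in>{..<n}. {0..<int (e j)})"
  define F where "F a = (\<lambda>x\<in>{0..<int n}. newton n a (nat x) mod int n)" for a
  have F_eq_iff: "F a = F b \<longleftrightarrow> (\<forall>j<n. int (e j) dvd a j - b j)" for a b
  proof -
    have "F a = F b \<longleftrightarrow> (\<forall>x\<in>{0..<int n}. newton n a (nat x) mod int n = newton n b (nat x) mod int n)"
      by (auto simp: F_def fun_eq_iff restrict_def)
    also have "\<dots> \<longleftrightarrow> (\<forall>x<n. newton n a x mod int n = newton n b x mod int n)"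
      by (metis atLeastLessThan_iff nat_int nat_less_iff of_nat_0_le_iff of_nat_less_iff)
    finally show ?thesis
      by (simp add: newton_cong_iff dvd_iff)
  qed
  have F_poly: "F a = poly_map n q" if "\<And>x. x < n \<Longrightarrow> poly q (int x) = newton n a x" for a q
  proof
    fix x
    show "F a x = poly_map n q x"
      using that[of "nat x"] by (auto simp: F_def poly_map_def nat_less_iff)
  qed
  have "bij_betw F A (carrier (G n))"
  proof (rule bij_betw_imageI)
    show "inj_on F A"
    proof (rule inj_onI)
      fix a b assume ab: "a \<in> A" "b \<in> A" and "F a = F b"
      then have "a j mod int (e j) = b j mod int (e j)" if "j < n" for j
        using that by (simp add: F_eq_iff mod_eq_dvd_iff)
      moreover have "a j mod int (e j) = a j" "b j mod int (e j) = b j" if "j < n" for j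
        using ab that by (auto simp: A_def PiE_iff)
      ultimately have "a j = b j" if "j < n" for j
        using that by metis
      then show "a = b"
        using ab by (intro PiE_ext[of a _ _ b]) (auto simp: A_def)
    qed
    show "F ` A = carrier (G n)"
      unfolding carrier_G[OF n]
    proof (intro equalityI subsetI)
      fix f assume "f \<in> F ` A"
      then show "f \<in> range (poly_map n)"
        using newton_poly[of n] F_poly by (metis imageE rangeI)
    next
      fix f assume "f \<in> range (poly_map n)"
      then obtain q where f: "f = poly_map n q" by blast
      obtain a where a: "\<And>x. x < n \<Longrightarrow> poly q (int x) = newton n a x"
        using newton_expansion by blast
      then have fa: "f = F a" unfolding f by (rule F_poly[symmetric])
      define b where "b = (\<lambda>j\<in>{..<n}. a j mod int (e j))"
      have "F a = F b"
        by (auto simp: F_eq_iff b_def simp flip: mod_eq_dvd_iff)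
      moreover have "b \<in> A"
        using e_pos by (auto simp: A_def b_def)
      ultimately show "f \<in> F ` A" using fa by blast
    qed
  qed
  then have "Psi n = card A"
    by (simp add: Psi_def bij_betw_same_card)
  also have "\<dots> = (\<Prod>j<n. e j)"
    by (simp add: A_def card_PiE)
  finally show ?thesis by (simp add: e_def)
qed

section \<open>Prime power moduli\<close>

lemma primepow_div_gcd:
  fixes p :: nat
  assumes p: "prime p"
  shows "p ^ k div gcd (p ^ k) m = p ^ card {i \<in> {1..k}. \<not> p ^ i dvd m}"
proof -
  obtain t where t: "t \<le> k" "gcd (p ^ k) m = p ^ t"
    using divides_primepow_nat[OF p, of "gcd (p ^ k) m" k] by auto
  have "p ^ i dvd m \<longleftrightarrow> i \<le> t" if "i \<le> k" for i
  proof -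
    have "p ^ i dvd m \<longleftrightarrow> p ^ i dvd gcd (p ^ k) m"
      using that by (simp add: le_imp_power_dvd)
    then show ?thesis
      using prime_ge_2_nat[OF p] by (simp add: t dvd_power_iff_le)
  qed
  then have "{i \<in> {1..k}. \<not> p ^ i dvd m} = {t<..k}"
    by auto
  then show ?thesis
    using t prime_gt_0_nat[OF p] by (simp add: power_diff)
qed

lemma dvd_fact_iff_smarandache_le:
  assumes "m > 0"
  shows "m dvd fact j \<longleftrightarrow> smarandache m \<le> j"
proof
  show "smarandache m \<le> j" if "m dvd fact j"
    unfolding smarandache_def using that by (rule Least_le)
  have "m dvd fact m" using assms by (simp add: dvd_fact)
  then have "m dvd fact (smarandache m)"
    unfolding smarandache_def by (rule LeastI)
  then show "m dvd fact j" if "smarandache m \<le> j"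
    using that by (meson dvd_trans fact_dvd)
qed

text \<open>
  A double count of the pairs \<open>(i, j)\<close> with \<open>1 \<le> i \<le> k\<close>, \<open>j < p\<^sup>k\<close> and \<open>p\<^sup>i\<close> not dividing \<open>j!\<close>. The
  bound on \<open>j\<close> cuts nothing off, since \<open>s(p\<^sup>i) \<le> p\<^sup>i \<le> p\<^sup>k\<close>.
\<close>
theorem Psi_primepow:
  fixes p :: nat
  assumes p: "prime p" and k: "k \<ge> 1"
  shows "Psi (p ^ k) = p ^ (\<Sum>i = 1..k. smarandache (p ^ i))"
proof -
  have p1: "p > 1" using p by (rule prime_gt_1_nat)
  then have n: "p ^ k > 1" using k by (intro one_less_power) auto
  have "Psi (p ^ k) = p ^ (\<Sum>j<p ^ k. card {i \<in> {1..k}. \<not> p ^ i dvd fact j})"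
    by (simp add: Psi_eq_prod[OF n] primepow_div_gcd[OF p] power_sum)
  also have "(\<Sum>j<p ^ k. card {i \<in> {1..k}. \<not> p ^ i dvd fact j})
      = (\<Sum>i = 1..k. card {j \<in> {..<p ^ k}. \<not> p ^ i dvd fact j})"
    by (rule sum_multicount_gen) auto
  also have "\<dots> = (\<Sum>i = 1..k. smarandache (p ^ i))"
  proof (rule sum.cong)
    fix i assume i: "i \<in> {1..k}"
    have "smarandache (p ^ i) \<le> p ^ i"
      using p1 by (simp add: dvd_fact flip: dvd_fact_iff_smarandache_le)
    also have "\<dots> \<le> p ^ k"
      using p1 i by (simp add: power_increasing)
    finally have "{j \<in> {..<p ^ k}. \<not> p ^ i dvd fact j} = {..<smarandache (p ^ i)}"
      using p1 by (auto simp: dvd_fact_iff_smarandache_le)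
    then show "card {j \<in> {..<p ^ k}. \<not> p ^ i dvd fact j} = smarandache (p ^ i)"
      by simp
  qed simp
  finally show ?thesis .
qed

text \<open>
  Instead of interpolating, one can count: for \<open>j < p\<close> the prime \<open>p\<close> does not divide \<open>j!\<close>, so
  \<open>Psi_eq_prod\<close> already yields as many polyfunctions as there are functions.
\<close>
lemma carrier_G_prime:
  assumes p: "prime p"
  shows "carrier (G p) = {0..<int p} \<rightarrow>\<^sub>E {0..<int p}"
proof (rule card_subset_eq)
  have p1: "p > 1" using p by (rule prime_gt_1_nat)
  show "finite ({0..<int p} \<rightarrow>\<^sub>E {0..<int p})" by (simp add: finite_PiE)
  show "carrier (G p) \<subseteq> {0..<int p} \<rightarrow>\<^sub>E {0..<int p}"
    using p1 by (auto simp: carrier_G poly_map_def)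
  have "coprime p (fact j)" if "j < p" for j
    using p that by (intro prime_imp_coprime) (auto simp: prime_dvd_fact_iff)
  then have "Psi p = p ^ p"
    using p1 by (simp add: Psi_eq_prod)
  then show "card (carrier (G p)) = card ({0..<int p} \<rightarrow>\<^sub>E {0..<int p})"
    by (simp add: Psi_def card_PiE)
qed

section \<open>Fibres of reduction and units\<close>

definition reduce :: "nat \<Rightarrow> (int \<Rightarrow> int) \<Rightarrow> int \<Rightarrow> int" where
  "reduce d f = (\<lambda>x\<in>{0..<int d}. f x mod int d)"

lemma reduce_poly_map:
  assumes "d dvd n" "n > 0"
  shows "reduce d (poly_map n q) = poly_map d q"
proof -
  have "d \<le> n" using assms by (simp add: dvd_imp_le)
  then show ?thesis
    using assms by (auto simp: reduce_def poly_map_def fun_eq_iff restrict_def mod_mod_cancel)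
qed

lemma finite_carrier_G:
  assumes "n > 1"
  shows "finite (carrier (G n))"
proof (rule finite_subset)
  show "carrier (G n) \<subseteq> {0..<int n} \<rightarrow>\<^sub>E {0..<int n}"
    using assms by (auto simp: carrier_G poly_map_def)
qed (simp add: finite_PiE)

text \<open>
  Adding the polyfunction of \<open>- u\<close> translates the fibre over the reduction of \<open>u\<close> to the fibre over 0.
\<close>
lemma card_reduce_fibre:
  assumes n: "n > 1" and dn: "d dvd n"
  shows "card {f \<in> carrier (G n). reduce d f = poly_map d u}
       = card {f \<in> carrier (G n). reduce d f = poly_map d 0}"
proof -
  define shift where "shift v f = (\<lambda>x\<in>{0..<int n}. (f x + poly v x) mod int n)" for v f
  have shift: "shift v (poly_map n q) = poly_map n (q + v)" for v q
    by (auto simp: shift_def poly_map_def fun_eq_iff restrict_def mod_simps)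
  have red: "reduce d (poly_map n q) = poly_map d q" for q
    using n dn by (simp add: reduce_poly_map)
  have add_cong: "poly_map d (q + v) = poly_map d (q' + v)" if "poly_map d q = poly_map d q'" for q q' v
    using that unfolding poly_map_eq_iff by (simp, metis mod_add_left_eq)
  have "bij_betw (shift (- u)) {f \<in> carrier (G n). reduce d f = poly_map d u}
          {f \<in> carrier (G n). reduce d f = poly_map d 0}"
  proof (rule bij_betw_byWitness[where f' = "shift u"])
    show "shift (- u) ` {f \<in> carrier (G n). reduce d f = poly_map d u}
        \<subseteq> {f \<in> carrier (G n). reduce d f = poly_map d 0}"
      using add_cong[of _ u "- u"] n by (auto simp: carrier_G shift red)
    show "shift u ` {f \<in> carrier (G n). reduce d f = poly_map d 0}
        \<subseteq> {f \<in> carrier (G n). reduce d f = poly_map d u}"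
      using add_cong[of _ 0 u] n by (auto simp: carrier_G shift red)
  qed (use n in \<open>auto simp: carrier_G shift\<close>)
  then show ?thesis by (rule bij_betw_same_card)
qed

lemma card_reduce_vimage:
  assumes n: "n > 1" and d: "d > 1" "d dvd n" and W: "W \<subseteq> carrier (G d)"
  shows "card {f \<in> carrier (G n). reduce d f \<in> W}
       = card W * card {f \<in> carrier (G n). reduce d f = poly_map d 0}"
proof -
  have fin: "finite (carrier (G n))" and finW: "finite W"
    using finite_carrier_G n d W by (auto intro: finite_subset)
  have "{f \<in> carrier (G n). reduce d f \<in> W} = (\<Union>g\<in>W. {f \<in> carrier (G n). reduce d f = g})"
    by blast
  then have "card {f \<in> carrier (G n). reduce d f \<in> W}
      = (\<Sum>g\<in>W. card {f \<in> carrier (G n). reduce d f = g})"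
    using fin finW by (simp, subst card_UN_disjoint) auto
  also have "\<dots> = (\<Sum>g\<in>W. card {f \<in> carrier (G n). reduce d f = poly_map d 0})"
  proof (rule sum.cong)
    fix g assume "g \<in> W"
    then obtain u where "g = poly_map d u" using W d by (auto simp: carrier_G)
    then show "card {f \<in> carrier (G n). reduce d f = g}
        = card {f \<in> carrier (G n). reduce d f = poly_map d 0}"
      using card_reduce_fibre[OF n d(2)] by simp
  qed simp
  finally show ?thesis by simp
qed

text \<open>
  If all values of \<open>q\<close> are coprime to \<open>n\<close>, then \<open>q ^ (totient n - 1)\<close> represents the inverse
  by Euler's theorem. The pointwise inverse is thus given by a polynomial.
\<close>
lemma poly_map_Units_iff:
  assumes n: "n > 1"
  shows "poly_map n q \<in> Units (G n) \<longleftrightarrow> (\<forall>x. coprime (poly q x) (int n))"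
proof -
  have mult: "poly_map n a \<otimes>\<^bsub>G n\<^esub> poly_map n b = poly_map n (a * b)" for a b
    by (auto simp: G_def polyfun_ring_def residue_ring_def poly_map_def fun_eq_iff
          restrict_def mod_simps)
  have one: "\<one>\<^bsub>G n\<^esub> = poly_map n 1"
    using n by (auto simp: G_def polyfun_ring_def residue_ring_def poly_map_def fun_eq_iff restrict_def)
  have units: "poly_map n q \<in> Units (G n) \<longleftrightarrow> (\<exists>r. poly_map n (q * r) = poly_map n 1)"
    using n by (auto simp: Units_def carrier_G mult one mult.commute)
  show ?thesis
  proof
    assume "poly_map n q \<in> Units (G n)"
    then obtain r where r: "poly_map n (q * r) = poly_map n 1"
      using units by blast
    show "\<forall>x. coprime (poly q x) (int n)"
    proof
      fix x
      define y where "y = x mod int n"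
      have "y \<in> {0..<int n}" using n by (simp add: y_def)
      then have "[poly q y * poly r y = 1] (mod int n)"
        using r by (auto simp: poly_map_eq_iff cong_def)
      then have "coprime (poly q y) (int n)"
        using coprime_iff_invertible_int by blast
      moreover have "poly q y mod int n = poly q x mod int n"
        unfolding y_def by (rule poly_mod_arg)
      ultimately show "coprime (poly q x) (int n)"
        using n by (metis coprime_mod_left_iff of_nat_0_eq_iff not_one_less_zero)
    qed
  next
    assume cop: "\<forall>x. coprime (poly q x) (int n)"
    interpret residues "int n" "residue_ring (int n)"
      using n by unfold_locales simp_all
    have "totient n > 0" using n by simp
    then have "q * q ^ (totient n - 1) = q ^ totient n"
      by (simp flip: power_Suc)
    moreover have "poly_map n (q ^ totient n) = poly_map n 1"
      using cop euler_theorem by (auto simp: poly_map_eq_iff poly_power cong_def)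
    ultimately show "poly_map n q \<in> Units (G n)"
      using units by metis
  qed
qed

lemma Units_G_primepow:
  assumes p: "prime p" and k: "k \<ge> 1"
  shows "Units (G (p ^ k))
       = {f \<in> carrier (G (p ^ k)). reduce p f \<in> {0..<int p} \<rightarrow>\<^sub>E {1..<int p}}"
proof -
  have p1: "p > 1" using p by (rule prime_gt_1_nat)
  then have n: "p ^ k > 1" using k by (intro one_less_power) auto
  have "poly_map (p ^ k) q \<in> Units (G (p ^ k))
      \<longleftrightarrow> reduce p (poly_map (p ^ k) q) \<in> {0..<int p} \<rightarrow>\<^sub>E {1..<int p}" for q
  proof -
    have "poly_map (p ^ k) q \<in> Units (G (p ^ k)) \<longleftrightarrow> (\<forall>x. poly q x mod int p \<noteq> 0)"
    proof -
      have "coprime a (int (p ^ k)) \<longleftrightarrow> a mod int p \<noteq> 0" for a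
        using p k by (metis coprime_commute coprime_power_left_iff dvd_eq_mod_eq_0 not_one_le_zero
            of_nat_power prime_imp_coprime prime_nat_int_transfer coprime_absorb_left not_prime_unit)
      then show ?thesis
        by (simp add: poly_map_Units_iff[OF n])
    qed
    also have "\<dots> \<longleftrightarrow> (\<forall>x\<in>{0..<int p}. poly q x mod int p \<noteq> 0)"
    proof (intro iffI ballI allI)
      fix x assume "\<forall>x\<in>{0..<int p}. poly q x mod int p \<noteq> 0"
      moreover have "x mod int p \<in> {0..<int p}" using p1 by simp
      ultimately show "poly q x mod int p \<noteq> 0"
        by (metis poly_mod_arg)
    qed simp
    also have "\<dots> \<longleftrightarrow> (\<forall>x\<in>{0..<int p}. poly q x mod int p \<in> {1..<int p})"
    proof -
      have "a mod int p \<noteq> 0 \<longleftrightarrow> a mod int p \<in> {1..<int p}" for a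
        using p1 pos_mod_bound[of "int p" a] pos_mod_sign[of "int p" a]
        unfolding atLeastLessThan_iff by linarith
      then show ?thesis by simp
    qed
    also have "\<dots> \<longleftrightarrow> poly_map p q \<in> {0..<int p} \<rightarrow>\<^sub>E {1..<int p}"
      by (simp add: poly_map_def PiE_iff)
    also have "poly_map p q = reduce p (poly_map (p ^ k) q)"
      using p1 k by (simp add: reduce_poly_map)
    finally show ?thesis .
  qed
  moreover have "Units (G (p ^ k)) \<subseteq> carrier (G (p ^ k))"
    by (auto simp: Units_def)
  ultimately show ?thesis
    unfolding carrier_G[OF n] by blast
qed

theorem card_Units_primepow:
  assumes p: "prime p" and k: "k \<ge> 1"
  shows "card (Units (G (p ^ k))) * p ^ p = (p - 1) ^ p * Psi (p ^ k)"
proof -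
  have p1: "p > 1" using p by (rule prime_gt_1_nat)
  then have n: "p ^ k > 1" using k by (intro one_less_power) auto
  have dvd: "p dvd p ^ k" using k by simp
  define K where "K = card {f \<in> carrier (G (p ^ k)). reduce p f = poly_map p 0}"
  have sub: "{0..<int p} \<rightarrow>\<^sub>E {1..<int p} \<subseteq> carrier (G p)"
    unfolding carrier_G_prime[OF p] by (intro PiE_mono) auto
  have "card (Units (G (p ^ k))) = (p - 1) ^ p * K"
    unfolding Units_G_primepow[OF p k] card_reduce_vimage[OF n p1 dvd sub] K_def
    using p1 by (simp add: card_PiE nat_diff_distrib)
  moreover have "{f \<in> carrier (G (p ^ k)). reduce p f \<in> carrier (G p)} = carrier (G (p ^ k))"
    using p1 dvd n by (auto simp: carrier_G reduce_poly_map)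
  then have "Psi (p ^ k) = p ^ p * K"
    using card_reduce_vimage[OF n p1 dvd subset_refl]
    unfolding Psi_def K_def by (simp add: carrier_G_prime[OF p] card_PiE)
  ultimately show ?thesis by simp
qed

theorem proposition22:
  fixes k :: nat
  assumes "k \<ge> 1"
  shows "real (order (units_of (G (3 ^ k)))) = (2 / 3) ^ 3 * real (Psi (3 ^ k))
    \<and> (2 / 3) ^ 3 * real (Psi (3 ^ k)) = (2 / 3) ^ 3 * 3 ^ (\<Sum>i = 1..k. smarandache (3 ^ i))
    \<and> real (order (units_of (G (3 ^ k)))) / real (order (G (3 ^ k))) = 8 / 27"
proof -
  have p: "prime (3 :: nat)" by simp
  have Psi: "Psi (3 ^ k) = 3 ^ (\<Sum>i = 1..k. smarandache (3 ^ i))"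
    by (rule Psi_primepow[OF p assms])
  have "order (units_of (G (3 ^ k))) * 27 = 8 * Psi (3 ^ k)"
    using card_Units_primepow[OF p assms] by (simp add: order_def units_of_def)
  then have units: "real (order (units_of (G (3 ^ k)))) = 8 / 27 * real (Psi (3 ^ k))"
    by linarith
  have "order (G (3 ^ k)) = Psi (3 ^ k)"
    by (simp add: order_def Psi_def)
  with units Psi show ?thesis
    by (simp add: power_divide)
qed

end
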